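(* Assume: (i) the distribution of $G_{it}$ given $(\alpha_i,\gamma_t)$ is invariant with respect to $(i,t)$; (ii) there exist $\lambda_i=U(\alpha_i)\in\mathbb{R}^{d_\lambda}$ and $f_t=V(\gamma_t)\in\mathbb{R}^{d_f}$, with $U:\Omega_\alpha\to\mathbb{R}^{d_\lambda}$ and $V:\Omega_\gamma\to\mathbb{R}^{d_f}$ measurable and $d_\lambda,d_f<\infty$, that are identified from the distribution of $\{Y_{it}:i\ge1,t\ge1\}$ and are injective. Then $g_0(\lambda_i,f_t):=\mathbb{E}[G_{it}\mid\lambda_i,f_t]$ satisfies $$g_0(\lambda_i,f_t)=g(\alpha_i,\gamma_t)=g\bigl(U^{-1}(\lambda_i),V^{-1}(f_t)\bigr),$$ so $g$ at the realised types is identified. Moreover, $g_0$ inherits the following modulus in the primitives. Suppose that (iii) for any given $(\alpha,\gamma)$ there exist $\delta=\delta(\alpha,\gamma)>0$ and $C=C(\alpha,\gamma)<\infty$ such that, whenever $\lVert(\alpha,\gamma)-(\alpha',\gamma')\rVert<\delta$, $$\lVert g(\alpha,\gamma)-g(\alpha',\gamma')\rVert\le C\{\lVert\alpha-\alpha'\rVert+\lVert\gamma-\gamma'\rVert\}.$$ Then, whenever $\lVert(\alpha,\gamma)-(\alpha',\gamma')\rVert<\delta(\alpha,\gamma)$, $$\lVert g_0(\lambda,f)-g_0(\lambda',f')\rVert\le C(\alpha,\gamma)\{\lVert\alpha-\alpha'\rVert+\lVert\gamma-\gamma'\rVert\},$$ with $(\lambda,f)=(U(\alpha),V(\gamma))$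 and $(\lambda',f')=(U(\alpha'),V(\gamma'))$. If in addition, for some $q\ge1$, $g$ is $C^q$ and $U$ and $V$ are injective $C^q$ immersions, then $g_0$ is $C^q$, differentiability being read on the image manifolds $U(\Omega_\alpha)$ and $V(\Omega_\gamma)$.
   Context: Model. For $i,t\ge1$ one observes $Y_{it}=m(\alpha_i,\gamma_t,\eta_{it})\in\mathbb{R}^{d_Y}$, where $\alpha_i\in\mathbb{R}^{d_\alpha}$ and $\gamma_t\in\mathbb{R}^{d_\gamma}$ are unobserved, with supports $\Omega_\alpha\subseteq\mathbb{R}^{d_\alpha}$ and $\Omega_\gamma\subseteq\mathbb{R}^{d_\gamma}$, and $\eta_{it}$ is an idiosyncratic shock. $G:\mathbb{R}^{d_Y}\to\mathbb{R}^{d_G}$ is a known transformation, $G_{it}:=G(Y_{it})$, and $g(\alpha_i,\gamma_t):=\mathbb{E}[G_{it}\mid\alpha_i,\gamma_t]$, i.e. $G_{it}=g(\alpha_i,\gamma_t)+\varepsilon_{it}$ with $\mathbb{E}[\varepsilon_{it}\mid\alpha_i,\gamma_t]=0$. All points $(\alpha,\gamma),(\alpha',\gamma')$ range over $\Omega_\alpha\times\Omega_\gamma$. $U^{-1}$ and $V^{-1}$ denote the inverses of the injective maps $U,V$ on their images $U(\Omega_\alpha)$ and $V(\Omega_\gamma)$. Identities between conditional expectations are understood in the usual almost-sure sense, and $g_0$ as a function on $U(\Omega_\alpha)\times V(\Omega_\gamma)$ is the version given by the identity, $g_0=g\circ(U^{-1},V^{-1})$. That $\lambda_i,f_t$ are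 identified from the distribution of $\{Y_{it}\}$ means that they may be treated as observed; "$g$ at the realised types is identified" means that $g(\alpha_i,\gamma_t)$ equals the identified function $g_0$ of $(\lambda_i,f_t)$. A $C^q$ immersion is a $C^q$ map whose derivative is injective (full column rank) at every point. *)

theory Defs
  imports "HOL-Probability.Probability"
begin

section \<open>Conditioning on a random vector\<close>

definition sigma_gen :: "'w measure \<Rightarrow> ('w \<Rightarrow> 'x::topological_space) \<Rightarrow> 'w measure" where
  "sigma_gen M X = vimage_algebra (space M) X borel"

text \<open>The library provides \<^const>\<open>real_cond_exp\<close> only; vector-valued conditional expectations
  are taken coordinatewise.\<close>

definition vec_cond_exp ::
    "'w measure \<Rightarrow> 'w measure \<Rightarrow> ('w \<Rightarrow> 'g::euclidean_space) \<Rightarrow> 'w \<Rightarrow> 'g" where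
  "vec_cond_exp M F Z w = (\<Sum>b\<in>Basis. real_cond_exp M F (\<lambda>w. Z w \<bullet> b) w *\<^sub>R b)"

definition cond_distribution ::
    "'w measure \<Rightarrow> ('w \<Rightarrow> 'x::topological_space) \<Rightarrow> ('w \<Rightarrow> 'g::topological_space)
      \<Rightarrow> ('x \<Rightarrow> 'g measure) \<Rightarrow> bool" where
  "cond_distribution M X Z \<kappa> \<longleftrightarrow>
     (\<forall>B\<in>sets borel. AE w in M.
        real_cond_exp M (sigma_gen M X) (indicat_real (Z -` B)) w = measure (\<kappa> (X w)) B)"

text \<open>Invariance in \<open>(i,t)\<close>: one and the same Markov kernel serves every pair \<open>i, t \<ge> 1\<close>.\<close>

definition invariant_cond_distribution ::
    "'w measure \<Rightarrow> 'x::topological_space set \<Rightarrow> (nat \<Rightarrow> nat \<Rightarrow> 'w \<Rightarrow> 'x)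
      \<Rightarrow> (nat \<Rightarrow> nat \<Rightarrow> 'w \<Rightarrow> 'g::topological_space) \<Rightarrow> bool" where
  "invariant_cond_distribution M S X Z \<longleftrightarrow>
     (\<exists>\<kappa> \<in> restrict_space borel S \<rightarrow>\<^sub>M prob_algebra borel.
        \<forall>i\<ge>1. \<forall>t\<ge>1. cond_distribution M (X i t) (Z i t) \<kappa>)"

section \<open>Supports and observables\<close>

text \<open>A Borel set carrying every \<open>X i\<close> almost surely, none of whose points can be removed
  together with a neighbourhood.  It need not be closed, so open supports are covered besides
  the closed topological support; the \<open>X i\<close> need not be identically distributed.\<close>

definition common_support ::
    "'w measure \<Rightarrow> nat set \<Rightarrow> (nat \<Rightarrow> 'w \<Rightarrow> 'x::topological_space) \<Rightarrow> 'x set \<Rightarrow> bool" where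
  "common_support M I X S \<longleftrightarrow>
     S \<in> sets borel \<and>
     (\<forall>i\<in>I. AE w in M. X i w \<in> S) \<and>
     (\<forall>x\<in>S. \<forall>N. open N \<longrightarrow> x \<in> N \<longrightarrow> (\<exists>i\<in>I. measure M {w \<in> space M. X i w \<in> N} > 0))"

definition data_array :: "(nat \<Rightarrow> nat \<Rightarrow> 'w \<Rightarrow> 'y) \<Rightarrow> 'w \<Rightarrow> nat \<times> nat \<Rightarrow> 'y" where
  "data_array Y w = restrict (\<lambda>(i, t). Y i t w) ({1..} \<times> {1..})"

text \<open>\<open>X\<close> may be treated as observed: it is almost surely a measurable function of the array
  \<open>{Y i t : i, t \<ge> 1}\<close>.  The law of the array is fixed with \<open>M\<close>, so \<open>\<Phi>\<close> may depend on it.\<close>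

definition identified_from ::
    "'w measure \<Rightarrow> (nat \<Rightarrow> nat \<Rightarrow> 'w \<Rightarrow> 'y::topological_space)
      \<Rightarrow> ('w \<Rightarrow> 'x::topological_space) \<Rightarrow> bool" where
  "identified_from M Y X \<longleftrightarrow>
     (\<exists>\<Phi> \<in> PiM ({1..} \<times> {1..}) (\<lambda>_. borel) \<rightarrow>\<^sub>M borel. AE w in M. X w = \<Phi> (data_array Y w))"

text \<open>\<open>g \<circ> (U\<^sup>-\<^sup>1, V\<^sup>-\<^sup>1)\<close>; meaningful on \<open>U ` A \<times> V ` B\<close> only.\<close>

definition factor_regression ::
    "'a set \<Rightarrow> 'c set \<Rightarrow> ('a \<Rightarrow> 'l) \<Rightarrow> ('c \<Rightarrow> 'f) \<Rightarrow> ('a \<times> 'c \<Rightarrow> 'g) \<Rightarrow> 'l \<times> 'f \<Rightarrow> 'g" where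
  "factor_regression A B U V g = g \<circ> map_prod (inv_into A U) (inv_into B V)"

section \<open>Maps of class C^q\<close>

text \<open>On open sets.  Iterated directional derivatives stand for the iterated Frechet
  derivatives, whose types would change with the order; in finite dimension this is the same.\<close>

primrec Cq_open ::
    "nat \<Rightarrow> ('a::euclidean_space \<Rightarrow> 'b::euclidean_space) \<Rightarrow> 'a set \<Rightarrow> bool" where
  "Cq_open 0 f S \<longleftrightarrow> continuous_on S f"
| "Cq_open (Suc q) f S \<longleftrightarrow>
     (\<forall>x\<in>S. f differentiable (at x)) \<and>
     (\<forall>v. Cq_open q (\<lambda>x. frechet_derivative f (at x) v) S)"

text \<open>On an arbitrary set (a support need not be open), C^q means that the map extends, near
  each point, to a C^q map on an open set.  For open sets this is \<^const>\<open>Cq_open\<close>.\<close>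

definition Cq_extension ::
    "nat \<Rightarrow> ('a::euclidean_space \<Rightarrow> 'b::euclidean_space) \<Rightarrow> 'a set \<Rightarrow> 'a
      \<Rightarrow> 'a set \<Rightarrow> ('a \<Rightarrow> 'b) \<Rightarrow> bool" where
  "Cq_extension q f S x N F \<longleftrightarrow>
     open N \<and> x \<in> N \<and> Cq_open q F N \<and> (\<forall>y \<in> N \<inter> S. F y = f y)"

definition Cq_on ::
    "nat \<Rightarrow> ('a::euclidean_space \<Rightarrow> 'b::euclidean_space) \<Rightarrow> 'a set \<Rightarrow> bool" where
  "Cq_on q f S \<longleftrightarrow> (\<forall>x\<in>S. \<exists>N F. Cq_extension q f S x N F)"

definition Cq_immersion_on ::
    "nat \<Rightarrow> ('a::euclidean_space \<Rightarrow> 'b::euclidean_space) \<Rightarrow> 'a set \<Rightarrow> bool" where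
  "Cq_immersion_on q f S \<longleftrightarrow>
     (\<forall>x\<in>S. \<exists>N F. Cq_extension q f S x N F \<and> inj (frechet_derivative F (at x)))"

text \<open>C^q on the image manifold \<open>W ` S\<close> of an injective immersion \<open>W\<close>: near each point, \<open>h\<close> is
  the restriction of a C^q function on an open subset of the ambient space.  Neighbourhoods in
  \<open>W ` S\<close> are those of the manifold topology, that is, images \<open>W ` (T \<inter> S)\<close> with \<open>T\<close> open.
  When \<open>W\<close> is an embedding they are the relative neighbourhoods and this is
  \<open>Cq_on q h (W ` S)\<close>; for an injective immersion that is not an embedding (such as an
  open interval laid out as a figure eight) the image need not be a manifold in the relative
  topology.\<close>

definition Cq_on_image ::
    "nat \<Rightarrow> ('a::euclidean_space \<Rightarrow> 'b::euclidean_space) \<Rightarrow> 'a set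
      \<Rightarrow> ('b \<Rightarrow> 'c::euclidean_space) \<Rightarrow> bool" where
  "Cq_on_image q W S h \<longleftrightarrow>
     (\<forall>x\<in>S. \<exists>T. open T \<and> x \<in> T \<and> (\<exists>N F. Cq_extension q h (W ` (T \<inter> S)) (W x) N F \<and>
        W ` (T \<inter> S) \<subseteq> N))"

end

theory Submission
  imports Defs
begin

text \<open>Up to null sets, \<open>(\<alpha> i, \<gamma> t)\<close> and \<open>(lam i, f t)\<close> are Borel functions of each other, so they
  generate the same conditional expectations; the Borel inverses of \<open>U\<close> and \<open>V\<close> come from compact
  pieces of their graphs.  For smoothness, compose the local extension of an immersion \<open>W\<close> with a
  linear left inverse \<open>L\<close> of its derivative at a point: the inverse function theorem inverts
  \<open>L \<circ> W\<close> near that point by a C^q map \<open>R\<close>, and \<open>g \<circ> R \<circ> L\<close> is a C^q extension of the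
  regression on the image manifold.\<close>

section \<open>Conditioning on almost surely equivalent random vectors\<close>

lemma subalgebra_sigma_gen:
  assumes "X \<in> borel_measurable M"
  shows "subalgebra M (sigma_gen M X)"
  unfolding subalgebra_def sigma_gen_def
  using assms by (auto simp: sets_image_in_sets)

lemma measurable_sigma_gen: "X \<in> borel_measurable (sigma_gen M X)"
  unfolding sigma_gen_def by (rule measurable_vimage_algebra1) simp

lemma sets_sigma_gen:
  "sets (sigma_gen M X) = {X -` B \<inter> space M | B. B \<in> sets borel}"
  unfolding sigma_gen_def by (rule sets_vimage_algebra2) simp

section \<open>Almost sure Borel inverses of injective maps\<close>

text \<open>Cutting a compact set by a closed set leaves it compact, so the projection argument
  below reaches closed targets directly; complements then give the open ones.\<close>

lemma borel_measurable_closedI: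
  fixes h :: "'a::topological_space \<Rightarrow> 'b::topological_space"
  assumes "\<And>C. closed C \<Longrightarrow> h -` C \<in> sets borel"
  shows "h \<in> borel_measurable borel"
proof (rule borel_measurableI)
  fix T :: "'b set" assume "open T"
  then have "h -` (- T) \<in> sets borel" by (intro assms) (simp add: closed_def)
  then have "- (h -` (- T)) \<in> sets borel" by (rule borel_comp)
  then show "h -` T \<inter> space borel \<in> sets borel" by (simp add: vimage_Compl)
qed

text \<open>Since the inverse is only needed almost everywhere, inner regularity of the law of
  \<open>(L, X)\<close> on the graph of \<open>U\<close> replaces the Lusin--Souslin theorem: on a countable union of
  compact pieces of the graph, preimages of closed sets under the inverse are countable unions
  of projections of compact sets.\<close>

lemma AE_borel_inverse:
  fixes X :: "'w \<Rightarrow> 'a::euclidean_space" and U :: "'a \<Rightarrow> 'l::euclidean_space"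
  assumes "finite_measure M" and X[measurable]: "X \<in> borel_measurable M"
    and L[measurable]: "L \<in> borel_measurable M"
    and S[measurable]: "S \<in> sets borel" and XS: "AE w in M. X w \<in> S"
    and U: "U \<in> borel_measurable (restrict_space borel S)" and inj: "inj_on U S"
    and LU: "AE w in M. L w = U (X w)"
  obtains \<phi> where "\<phi> \<in> borel_measurable borel" "AE w in M. X w = \<phi> (L w)"
proof -
  interpret finite_measure M by fact
  \<comment> \<open>Extending \<open>U\<close> by zero off \<open>S\<close> makes it Borel on the
    whole space, so its graph over \<open>S\<close> is cut out by a measurable predicate.\<close>
  have Ut[measurable]: "(\<lambda>a. indicator S a *\<^sub>R U a) \<in> borel_measurable borel"
    using U by (subst (asm) borel_measurable_restrict_space_iff) auto
  \<comment> \<open>The graph of \<open>U\<close> over \<open>S\<close> with the value in the first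
    coordinate, so that \<open>fst\<close> projects to the space of \<open>L\<close>.\<close>
  define \<Gamma> where "\<Gamma> = {p :: 'l \<times> 'a. snd p \<in> S \<and> fst p = indicator S (snd p) *\<^sub>R U (snd p)}"
  have \<Gamma>: "\<Gamma> \<in> sets borel"
  proof -
    have "Measurable.pred (borel :: ('l \<times> 'a) measure) (\<lambda>p. snd p \<in> S \<and> fst p = indicator S (snd p) *\<^sub>R U (snd p))"
      unfolding borel_prod[symmetric] by measurable
    then show ?thesis unfolding \<Gamma>_def pred_def by simp
  qed
  define \<nu> where "\<nu> = distr M borel (\<lambda>w. (L w, X w))"
  have LX[measurable]: "(\<lambda>w. (L w, X w)) \<in> borel_measurable M"
    by measurable
  have s\<nu>: "sets \<nu> = sets borel" by (simp add: \<nu>_def)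
  interpret \<nu>: finite_measure \<nu> unfolding \<nu>_def by (rule finite_measure_distr) fact
  have ae\<Gamma>: "AE p in \<nu>. p \<in> \<Gamma>"
    unfolding \<nu>_def using XS LU \<Gamma>
    by (subst AE_distr_iff) (auto simp: \<Gamma>_def elim: eventually_elim2)
  have "emeasure \<nu> \<Gamma> = (SUP K \<in> {K. K \<subseteq> \<Gamma> \<and> compact K}. emeasure \<nu> K)"
    by (rule inner_regular[OF s\<nu>]) (auto simp: \<Gamma>)
  \<comment> \<open>The supremum over all compact subsets is replaced by one along a sequence, since
    only a countable union is sure to be Borel.\<close>
  moreover have "{K. K \<subseteq> \<Gamma> \<and> compact K} \<noteq> {}" by (auto intro: exI[of _ "{}"])
  from ennreal_SUP_countable_SUP[OF this, of "emeasure \<nu>"] obtain e :: "nat \<Rightarrow> ennreal"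
    where e: "range e \<subseteq> emeasure \<nu> ` {K. K \<subseteq> \<Gamma> \<and> compact K}"
      "(SUP K \<in> {K. K \<subseteq> \<Gamma> \<and> compact K}. emeasure \<nu> K) = (SUP n. e n)"
    by auto
  ultimately have eSUP: "emeasure \<nu> \<Gamma> = (SUP n. e n)" by simp
  have "\<forall>n. \<exists>K. K \<subseteq> \<Gamma> \<and> compact K \<and> e n = emeasure \<nu> K" using e(1) by blast
  then obtain K where K: "\<And>n. K n \<subseteq> \<Gamma>" "\<And>n. compact (K n)" "\<And>n. e n = emeasure \<nu> (K n)"
    by metis
  define Q where "Q = (\<Union>n. K n)"
  have Qm: "Q \<in> sets \<nu>" unfolding Q_def s\<nu> using K(2) by (auto intro: borel_compact)
  have Q\<Gamma>: "Q \<subseteq> \<Gamma>" using K(1) by (auto simp: Q_def)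
  \<comment> \<open>Each \<open>K n\<close> lies in \<open>Q\<close>, so \<open>Q\<close> carries at
    least the supremum of the \<open>e n\<close>, which is all of the mass of
    \<open>\<Gamma>\<close>.\<close>
  have "emeasure \<nu> \<Gamma> \<le> emeasure \<nu> Q"
    unfolding eSUP K(3) by (intro SUP_least emeasure_mono) (auto simp: Q_def Qm[unfolded Q_def])
  with Q\<Gamma> have "emeasure \<nu> Q = emeasure \<nu> \<Gamma>"
    using \<Gamma> by (simp add: antisym emeasure_mono s\<nu>)
  also have "\<dots> = emeasure \<nu> (space \<nu>)"
  proof (rule emeasure_eq_AE)
    show "AE p in \<nu>. p \<in> \<Gamma> \<longleftrightarrow> p \<in> space \<nu>"
      using ae\<Gamma> AE_space by eventually_elim simp
  qed (use \<Gamma> s\<nu> in auto)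
  finally have "space \<nu> - Q \<in> null_sets \<nu>"
    using Qm by (simp add: null_sets_def emeasure_compl)
  then have "AE p in \<nu>. p \<in> Q"
    by (rule AE_I') auto
  then have aeQ: "AE w in M. (L w, X w) \<in> Q"
    unfolding \<nu>_def using Qm by (subst (asm) AE_distr_iff) (auto simp: s\<nu>)
  \<comment> \<open>Here injectivity enters: read backwards, \<open>Q\<close> is the graph of a
    partial function.\<close>
  have uniq: "a = b" if "(u, a) \<in> Q" "(u, b) \<in> Q" for u a b
    using subsetD[OF Q\<Gamma> that(1)] subsetD[OF Q\<Gamma> that(2)] inj by (auto simp: \<Gamma>_def inj_on_def)
  define \<phi> where "\<phi> u = (if u \<in> fst ` Q then (THE a. (u, a) \<in> Q) else 0)" for u
  have \<phi>Q: "\<phi> u = a" if "(u, a) \<in> Q" for u a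
  proof -
    have "u \<in> fst ` Q" using that by force
    moreover have "(THE a. (u, a) \<in> Q) = a" using that by (rule the_equality) (rule uniq[OF _ that])
    ultimately show ?thesis by (simp add: \<phi>_def)
  qed
  have proj: "fst ` (Q \<inter> UNIV \<times> C) \<in> sets borel" if "closed C" for C :: "'a set"
  proof -
    have "fst ` (Q \<inter> UNIV \<times> C) = (\<Union>n. fst ` (K n \<inter> UNIV \<times> C))" by (auto simp: Q_def)
    moreover have "compact (fst ` (K n \<inter> UNIV \<times> C))" for n
      using that K(2) by (intro compact_continuous_image continuous_intros compact_Int_closed closed_Times) auto
    then have "(\<Union>n. fst ` (K n \<inter> UNIV \<times> C)) \<in> sets borel"
      by (intro sets.countable_UN) (simp add: image_subset_iff borel_compact)
    ultimately show ?thesis by simp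
  qed
  have "\<phi> \<in> borel_measurable borel"
  proof (rule borel_measurable_closedI)
    fix C :: "'a set" assume "closed C"
    have "\<phi> u \<in> C \<longleftrightarrow> u \<in> fst ` (Q \<inter> UNIV \<times> C) \<union> (if 0 \<in> C then - fst ` Q else {})" for u
    proof (cases "u \<in> fst ` Q")
      case True
      then obtain a where a: "(u, a) \<in> Q" by auto
      have "u \<in> fst ` (Q \<inter> UNIV \<times> C) \<longleftrightarrow> a \<in> C"
      proof
        assume "u \<in> fst ` (Q \<inter> UNIV \<times> C)"
        then obtain b where "(u, b) \<in> Q" "b \<in> C" by auto
        then show "a \<in> C" using uniq[OF a] by metis
      next
        assume "a \<in> C"
        with a have "(u, a) \<in> Q \<inter> UNIV \<times> C" by simp
        then show "u \<in> fst ` (Q \<inter> UNIV \<times> C)" by (rule rev_image_eqI) simp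
      qed
      with True \<phi>Q[OF a] show ?thesis by simp
    next
      case False
      then show ?thesis by (auto simp: \<phi>_def)
    qed
    then have "\<phi> -` C = fst ` (Q \<inter> UNIV \<times> C) \<union> (if 0 \<in> C then - fst ` Q else {})"
      by (intro set_eqI) (simp only: vimage_eq)
    then show "\<phi> -` C \<in> sets borel"
      using proj[OF \<open>closed C\<close>] proj[OF closed_UNIV] by (simp add: borel_comp)
  qed
  moreover have "AE w in M. X w = \<phi> (L w)" using aeQ by eventually_elim (rule \<phi>Q[symmetric])
  ultimately show thesis by (rule that)
qed

section \<open>Transfer of conditional expectations between equivalent vectors\<close>

text \<open>Since \<open>X'\<close> is almost surely \<open>\<Phi>\<close> of \<open>X\<close>,
  every event of \<open>X'\<close> is an event of \<open>X\<close> up to a null set, so the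
  averaging identities carry over. \<open>\<Psi>\<close> rewrites the candidate
  \<open>k (X w)\<close> as a function of \<open>X'\<close>, hence measurable for its
  sigma-algebra.\<close>

lemma real_cond_exp_sigma_gen_transfer:
  assumes "finite_measure M" and [measurable]: "X \<in> borel_measurable M" "X' \<in> borel_measurable M"
    and "\<Phi> \<in> borel_measurable borel" "\<Psi> \<in> borel_measurable borel" "k \<in> borel_measurable borel"
    and X': "AE w in M. X' w = \<Phi> (X w)" and X: "AE w in M. X w = \<Psi> (X' w)"
    and Z: "integrable M Z"
    and ce: "AE w in M. real_cond_exp M (sigma_gen M X) Z w = k (X w)"
  shows "AE w in M. real_cond_exp M (sigma_gen M X') Z w = k (\<Psi> (X' w))"
proof -
  interpret X: finite_measure_subalgebra M "sigma_gen M X"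
    using assms(1) by (simp add: finite_measure_subalgebra_def finite_measure_subalgebra_axioms_def
        subalgebra_sigma_gen)
  interpret X': finite_measure_subalgebra M "sigma_gen M X'"
    using assms(1) by (simp add: finite_measure_subalgebra_def finite_measure_subalgebra_axioms_def
        subalgebra_sigma_gen)
  note [measurable] = assms(4-6)
  have eq: "AE w in M. real_cond_exp M (sigma_gen M X) Z w = k (\<Psi> (X' w))"
    using ce X by eventually_elim simp
  show ?thesis
  proof (rule X'.real_cond_exp_charact)
    show "(\<lambda>w. k (\<Psi> (X' w))) \<in> borel_measurable (sigma_gen M X')"
      using measurable_sigma_gen[of X' M] by measurable
    show "integrable M (\<lambda>w. k (\<Psi> (X' w)))"
      by (rule integrable_cong_AE_imp[OF X.real_cond_exp_int(1)[OF Z]]) (use eq in auto)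
    fix A assume "A \<in> sets (sigma_gen M X')"
    then obtain B where [measurable]: "B \<in> sets borel" and A: "A = X' -` B \<inter> space M"
      by (auto simp: sets_sigma_gen)
    \<comment> \<open>\<open>A\<close> is the event that \<open>X'\<close> lies in \<open>B\<close>;
      replacing \<open>X'\<close> by \<open>\<Phi>\<close> of \<open>X\<close> gives an event
      generated by \<open>X\<close> that differs from \<open>A\<close> by a null set.\<close>
    define A' where "A' = (\<lambda>w. \<Phi> (X w)) -` B \<inter> space M"
    have "A' = X -` (\<Phi> -` B) \<inter> space M" by (auto simp: A'_def)
    moreover have "\<Phi> -` B \<in> sets borel" using measurable_sets[OF assms(4), of B] by simp
    ultimately have A': "A' \<in> sets (sigma_gen M X)" by (auto simp: sets_sigma_gen)
    have [measurable]: "A \<in> sets M" "A' \<in> sets M" by (auto simp: A A'_def)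
    have AA': "AE w in M. w \<in> A \<longleftrightarrow> w \<in> A'" using X' by (auto simp: A A'_def)
    have "(\<integral>w\<in>A. Z w \<partial>M) = (\<integral>w\<in>A'. Z w \<partial>M)"
      using Z AA' by (intro set_integral_cong_set) (auto simp: set_borel_measurable_def)
    also have "\<dots> = (\<integral>w\<in>A'. real_cond_exp M (sigma_gen M X) Z w \<partial>M)"
      using Z A' by (rule X.real_cond_exp_intA)
    also have "\<dots> = (\<integral>w\<in>A. k (\<Psi> (X' w)) \<partial>M)"
      unfolding set_lebesgue_integral_def
      by (rule integral_cong_AE) (use AA' eq in \<open>auto simp: indicator_def elim!: eventually_elim2\<close>)
    finally show "(\<integral>w\<in>A. Z w \<partial>M) = (\<integral>w\<in>A. k (\<Psi> (X' w)) \<partial>M)" .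
  qed (fact Z)
qed

lemma vec_cond_exp_inner:
  "b \<in> Basis \<Longrightarrow> vec_cond_exp M F Z w \<bullet> b = real_cond_exp M F (\<lambda>w. Z w \<bullet> b) w"
  by (simp add: vec_cond_exp_def inner_sum_left inner_Basis if_distrib cong: if_cong)

lemma vec_cond_exp_sigma_gen_transfer:
  fixes Z :: "'w \<Rightarrow> 'g::euclidean_space"
  assumes "finite_measure M" "X \<in> borel_measurable M" "X' \<in> borel_measurable M"
    and "\<Phi> \<in> borel_measurable borel" "\<Psi> \<in> borel_measurable borel" "k \<in> borel_measurable borel"
    and "AE w in M. X' w = \<Phi> (X w)" and "AE w in M. X w = \<Psi> (X' w)"
    and Z: "integrable M Z"
    and ce: "AE w in M. vec_cond_exp M (sigma_gen M X) Z w = k (X w)"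
  shows "AE w in M. vec_cond_exp M (sigma_gen M X') Z w = k (\<Psi> (X' w))"
proof -
  have "AE w in M. real_cond_exp M (sigma_gen M X') (\<lambda>w. Z w \<bullet> b) w = k (\<Psi> (X' w)) \<bullet> b"
    if b: "b \<in> Basis" for b
  proof (rule real_cond_exp_sigma_gen_transfer[where k="\<lambda>x. k x \<bullet> b", OF assms(1-5) _ assms(7,8)])
    show "AE w in M. real_cond_exp M (sigma_gen M X) (\<lambda>w. Z w \<bullet> b) w = k (X w) \<bullet> b"
      using ce by eventually_elim (simp flip: vec_cond_exp_inner[OF b])
  qed (use assms(6) Z in auto)
  \<comment> \<open>There are finitely many coordinates, so their exceptional null sets merge into
    one.\<close>
  then have "AE w in M. \<forall>b\<in>Basis. real_cond_exp M (sigma_gen M X') (\<lambda>w. Z w \<bullet> b) w = k (\<Psi> (X' w)) \<bullet> b"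
    by (intro AE_finite_allI) auto
  then show ?thesis
    by eventually_elim (auto simp: vec_cond_exp_inner intro: euclidean_eqI)
qed

text \<open>\<open>h\<close> is \<open>g\<close>, extended by zero, after the almost sure Borel
  inverses of \<open>U\<close> and \<open>V\<close>. It supplies a globally Borel version of the
  regression, which a composition with \<open>inv_into\<close> does not visibly give.\<close>

lemma vec_cond_exp_injective_image:
  fixes X :: "'w \<Rightarrow> 'a::euclidean_space" and W :: "'w \<Rightarrow> 'c::euclidean_space"
    and U :: "'a \<Rightarrow> 'l::euclidean_space" and V :: "'c \<Rightarrow> 'f::euclidean_space"
    and g :: "'a \<times> 'c \<Rightarrow> 'g::euclidean_space"
  assumes fin: "finite_measure M" and X: "X \<in> borel_measurable M" and W: "W \<in> borel_measurable M"
    and A: "A \<in> sets borel" and B: "B \<in> sets borel"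
    and XA: "AE w in M. X w \<in> A" and WB: "AE w in M. W w \<in> B"
    and U: "U \<in> borel_measurable (restrict_space borel A)"
    and V: "V \<in> borel_measurable (restrict_space borel B)"
    and inj: "inj_on U A" "inj_on V B"
    and L: "L \<in> borel_measurable M" and F: "F \<in> borel_measurable M"
    and LU: "AE w in M. L w = U (X w)" and FV: "AE w in M. F w = V (W w)"
    and g: "g \<in> borel_measurable (restrict_space borel (A \<times> B))"
    and Z: "integrable M Z"
    and ce: "AE w in M. vec_cond_exp M (sigma_gen M (\<lambda>w. (X w, W w))) Z w = g (X w, W w)"
  obtains h where "h \<in> borel_measurable borel" "AE w in M. h (L w, F w) = g (X w, W w)"
    "AE w in M. vec_cond_exp M (sigma_gen M (\<lambda>w. (L w, F w))) Z w = h (L w, F w)"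
proof -
  obtain \<phi> where \<phi>: "\<phi> \<in> borel_measurable borel" and X\<phi>: "AE w in M. X w = \<phi> (L w)"
    by (rule AE_borel_inverse[OF fin X L A XA U inj(1) LU])
  obtain \<psi> where \<psi>: "\<psi> \<in> borel_measurable borel" and W\<psi>: "AE w in M. W w = \<psi> (F w)"
    by (rule AE_borel_inverse[OF fin W F B WB V inj(2) FV])
  have AB: "A \<times> B \<in> sets borel" using A B by (simp flip: borel_prod)
  \<comment> \<open>The transfer asks for Borel maps on whole spaces. Zero extensions provide them
    and change nothing on the supports, where the types lie almost surely.\<close>
  define k where "k p = indicator (A \<times> B) p *\<^sub>R g p" for p
  define U' where "U' a = indicator A a *\<^sub>R U a" for a
  define V' where "V' c = indicator B c *\<^sub>R V c" for c
  have k: "k \<in> borel_measurable borel"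
    unfolding k_def using g AB by (simp add: borel_measurable_restrict_space_iff)
  have U': "U' \<in> borel_measurable borel" and V': "V' \<in> borel_measurable borel"
    unfolding U'_def V'_def using U V A B by (simp_all add: borel_measurable_restrict_space_iff)
  have kg: "AE w in M. k (X w, W w) = g (X w, W w)"
    using XA WB by eventually_elim (simp add: k_def)
  have map_prod: "map_prod r s \<in> borel_measurable borel"
    if "r \<in> borel_measurable borel" "s \<in> borel_measurable borel"
    for r :: "'x::euclidean_space \<Rightarrow> 'y::euclidean_space" and s :: "'u::euclidean_space \<Rightarrow> 'v::euclidean_space"
    unfolding map_prod_def case_prod_beta borel_prod[symmetric] using that by measurable
  have "AE w in M. vec_cond_exp M (sigma_gen M (\<lambda>w. (L w, F w))) Z w = k (map_prod \<phi> \<psi> (L w, F w))"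
  proof (rule vec_cond_exp_sigma_gen_transfer[OF fin borel_measurable_Pair[OF X W]
        borel_measurable_Pair[OF L F] map_prod[OF U' V'] map_prod[OF \<phi> \<psi>] k _ _ Z])
    show "AE w in M. (L w, F w) = map_prod U' V' (X w, W w)"
      using XA WB LU FV by eventually_elim (simp add: U'_def V'_def)
    show "AE w in M. (X w, W w) = map_prod \<phi> \<psi> (L w, F w)"
      using X\<phi> W\<psi> by eventually_elim simp
    show "AE w in M. vec_cond_exp M (sigma_gen M (\<lambda>w. (X w, W w))) Z w = k (X w, W w)"
      using ce kg by eventually_elim simp
  qed
  moreover have "AE w in M. k (map_prod \<phi> \<psi> (L w, F w)) = g (X w, W w)"
    using kg X\<phi> W\<psi> by eventually_elim simp
  ultimately show thesis
    using that[of "\<lambda>p. k (map_prod \<phi> \<psi> p)"] measurable_compose[OF map_prod[OF \<phi> \<psi>] k] by blast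
qed

text \<open>Composing \<open>h\<close> with the two recovery maps of the array recovers
  \<open>R\<close>; this carries identification from the transformed types to the value of
  \<open>g\<close>.\<close>

lemma identified_from_Pair:
  fixes X :: "'w \<Rightarrow> 'x::second_countable_topology" and W :: "'w \<Rightarrow> 'z::second_countable_topology"
  assumes "identified_from M Y X" "identified_from M Y W"
    and h: "h \<in> borel_measurable borel" and eq: "AE w in M. h (X w, W w) = R w"
  shows "identified_from M Y R"
proof -
  obtain \<Phi> \<Psi> where \<Phi>: "\<Phi> \<in> PiM ({1..} \<times> {1..}) (\<lambda>_. borel) \<rightarrow>\<^sub>M borel" "AE w in M. X w = \<Phi> (data_array Y w)"
    and \<Psi>: "\<Psi> \<in> PiM ({1..} \<times> {1..}) (\<lambda>_. borel) \<rightarrow>\<^sub>M borel" "AE w in M. W w = \<Psi> (data_array Y w)"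
    using assms(1,2) by (auto simp: identified_from_def)
  have "(\<lambda>d. h (\<Phi> d, \<Psi> d)) \<in> PiM ({1..} \<times> {1..}) (\<lambda>_. borel) \<rightarrow>\<^sub>M borel"
    by (rule measurable_compose[OF borel_measurable_Pair[OF \<Phi>(1) \<Psi>(1)] h])
  moreover have "AE w in M. R w = h (\<Phi> (data_array Y w), \<Psi> (data_array Y w))"
    using eq \<Phi>(2) \<Psi>(2) by eventually_elim simp
  ultimately show ?thesis
    unfolding identified_from_def by (intro bexI[where x="\<lambda>d. h (\<Phi> d, \<Psi> d)"])
qed

section \<open>Calculus of C^q maps\<close>

text \<open>On an open set derivatives depend only on the values there, so the equality passes to
  the directional derivatives and the induction continues with them.\<close>

lemma Cq_open_cong:
  assumes "open S" "\<And>x. x \<in> S \<Longrightarrow> f x = g x" "Cq_open q f S"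
  shows "Cq_open q g S"
  using assms
proof (induction q arbitrary: f g)
  case 0
  then show ?case by (simp cong: continuous_on_cong)
next
  case (Suc q)
  have D: "(g has_derivative frechet_derivative f (at x)) (at x)" if "x \<in> S" for x
    using Suc.prems that
    by (intro has_derivative_transform_within_open[of f _ x UNIV S g])
      (auto simp: frechet_derivative_works)
  have "Cq_open q (\<lambda>x. frechet_derivative g (at x) v) S" for v
    by (rule Suc.IH[of "\<lambda>x. frechet_derivative f (at x) v"])
      (use Suc.prems D frechet_derivative_at in \<open>fastforce+\<close>)
  then show ?case using D by (auto simp: differentiable_def)
qed

lemma Cq_open_subset:
  assumes "T \<subseteq> S" "Cq_open q f S"
  shows "Cq_open q f T"
  using assms by (induction q arbitrary: f) (auto intro: continuous_on_subset)

text \<open>By uniqueness of derivatives, any explicit formula \<open>D\<close> may replace the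
  chosen \<open>frechet_derivative\<close>. The rules below all use this to step up one
  order.\<close>

lemma Cq_open_SucI:
  assumes "open S" "\<And>x. x \<in> S \<Longrightarrow> (f has_derivative (\<lambda>v. D v x)) (at x)"
    "\<And>v. Cq_open q (D v) S"
  shows "Cq_open (Suc q) f S"
proof -
  have "Cq_open q (\<lambda>x. frechet_derivative f (at x) v) S" for v
    by (rule Cq_open_cong[OF assms(1) _ assms(3)[of v]])
      (use frechet_derivative_at[OF assms(2)] in metis)
  then show ?thesis using assms(2) by (auto simp: differentiable_def)
qed

lemma Cq_open_SucD:
  assumes "Cq_open (Suc q) f S"
  shows "x \<in> S \<Longrightarrow> (f has_derivative frechet_derivative f (at x)) (at x)"
    "Cq_open q (\<lambda>x. frechet_derivative f (at x) v) S"
  using assms by (auto simp: frechet_derivative_works)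

lemma Cq_open_Suc_imp: "Cq_open (Suc q) f S \<Longrightarrow> Cq_open q f S"
proof (induction q arbitrary: f)
  case 0
  then show ?case
    by (auto intro!: continuous_at_imp_continuous_on differentiable_imp_continuous_within)
qed auto

lemma Cq_open_imp_continuous_on: "Cq_open q f S \<Longrightarrow> continuous_on S f"
  by (induction q) (auto dest: Cq_open_Suc_imp simp del: Cq_open.simps(2))

lemma Cq_open_const: "open S \<Longrightarrow> Cq_open q (\<lambda>x. c) S"
  by (induction q arbitrary: c) auto

lemma Cq_open_linear:
  fixes L :: "'a::euclidean_space \<Rightarrow> 'b::euclidean_space"
  assumes "open S" "linear L"
  shows "Cq_open q L S"
proof (cases q)
  case 0
  then show ?thesis using assms by (simp add: linear_continuous_on linear_conv_bounded_linear)
next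
  case (Suc k)
  show ?thesis unfolding Suc
    by (rule Cq_open_SucI[where D="\<lambda>v x. L v"])
      (use assms in \<open>auto simp: Cq_open_const linear_conv_bounded_linear
        intro: bounded_linear_imp_has_derivative\<close>)
qed

lemma Cq_open_linear_compose:
  assumes "open S" "linear L" "Cq_open q f S"
  shows "Cq_open q (\<lambda>x. L (f x)) S"
  using assms(3)
proof (induction q arbitrary: f)
  case 0
  then show ?case using assms(2)
    by (auto simp: linear_conv_bounded_linear intro: bounded_linear.continuous_on)
next
  case (Suc q)
  note f = Cq_open_SucD[OF Suc.prems]
  show ?case
    by (rule Cq_open_SucI[OF assms(1) _ Suc.IH[OF f(2)]])
      (use assms(2) in \<open>auto simp: linear_conv_bounded_linear intro: bounded_linear.has_derivative f(1)\<close>)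
qed

lemma Cq_open_add:
  assumes "open S" "Cq_open q f S" "Cq_open q g S"
  shows "Cq_open q (\<lambda>x. f x + g x) S"
  using assms(2,3)
proof (induction q arbitrary: f g)
  case 0
  then show ?case by (auto intro: continuous_on_add)
next
  case (Suc q)
  note f = Cq_open_SucD[OF Suc.prems(1)] and g = Cq_open_SucD[OF Suc.prems(2)]
  show ?case
    by (rule Cq_open_SucI[OF assms(1) _ Suc.IH[OF f(2) g(2)]]) (auto intro: has_derivative_add f(1) g(1))
qed

lemma Cq_open_sum:
  assumes "open S" "\<And>i. i \<in> I \<Longrightarrow> Cq_open q (f i) S"
  shows "Cq_open q (\<lambda>x. \<Sum>i\<in>I. f i x) S"
  using assms(2)
  by (induction I rule: infinite_finite_induct) (auto intro!: Cq_open_add Cq_open_const assms(1))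

text \<open>In the product rule each term keeps one factor undifferentiated; that factor is first
  lowered by one order so that the induction hypothesis fits.\<close>

lemma Cq_open_scaleR:
  assumes "open S" "Cq_open q r S" "Cq_open q k S"
  shows "Cq_open q (\<lambda>x. r x *\<^sub>R k x) S"
  using assms(2,3)
proof (induction q arbitrary: r k)
  case 0
  then show ?case by (auto intro: continuous_on_scaleR)
next
  case (Suc q)
  note r = Cq_open_SucD[OF Suc.prems(1)] and k = Cq_open_SucD[OF Suc.prems(2)]
  note r' = Cq_open_Suc_imp[OF Suc.prems(1)] and k' = Cq_open_Suc_imp[OF Suc.prems(2)]
  show ?case
    by (rule Cq_open_SucI[OF assms(1) _ Cq_open_add[OF assms(1) Suc.IH[OF r' k(2)] Suc.IH[OF r(2) k']]])
      (auto intro: has_derivative_scaleR r(1) k(1))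
qed

lemma Cq_open_inner_left:
  "open S \<Longrightarrow> Cq_open q f S \<Longrightarrow> Cq_open q (\<lambda>x. f x \<bullet> b) S"
  by (rule Cq_open_linear_compose) (auto intro: linearI simp: inner_left_distrib)

text \<open>Turns the application of a varying linear map to a varying vector into a finite sum of
  products, to which the sum and product rules for C^q maps apply.\<close>

lemma linear_euclidean_representation:
  fixes f :: "'a::euclidean_space \<Rightarrow> 'b::real_vector"
  assumes "linear f"
  shows "f v = (\<Sum>b\<in>Basis. (v \<bullet> b) *\<^sub>R f b)"
proof -
  interpret linear f by fact
  have "f v = f (\<Sum>b\<in>Basis. (v \<bullet> b) *\<^sub>R b)" by (simp only: euclidean_representation)
  then show ?thesis by (simp add: sum scaleR)
qed

lemma Cq_open_compose:
  fixes f :: "'a::euclidean_space \<Rightarrow> 'b::euclidean_space"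
    and h :: "'b \<Rightarrow> 'c::euclidean_space"
  assumes "open S" "open T" "f ` S \<subseteq> T" "Cq_open q f S" "Cq_open q h T"
  shows "Cq_open q (\<lambda>x. h (f x)) S"
  using assms(4,5)
proof (induction q arbitrary: h)
  case 0
  then show ?case using assms(3) by (auto intro: continuous_on_compose2)
next
  case (Suc q)
  note f = Cq_open_SucD[OF Suc.prems(1)] and h = Cq_open_SucD[OF Suc.prems(2)]
  note f' = Cq_open_Suc_imp[OF Suc.prems(1)]
  \<comment> \<open>The chain rule with the inner derivative expanded in the basis of the
    intermediate space. Each \<open>frechet_derivative h (at (f x)) b\<close> is again a composition
    with \<open>f\<close>, of order one less, so \<open>h\<close> must vary in the
    induction.\<close>
  let ?D = "\<lambda>v x. \<Sum>b\<in>Basis. (frechet_derivative f (at x) v \<bullet> b) *\<^sub>R frechet_derivative h (at (f x)) b"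
  show ?case
  proof (rule Cq_open_SucI[OF assms(1)])
    fix x assume x: "x \<in> S"
    with assms(3) have "f x \<in> T" by auto
    note h1 = h(1)[OF this]
    have "((\<lambda>x. h (f x)) has_derivative
        (\<lambda>v. frechet_derivative h (at (f x)) (frechet_derivative f (at x) v))) (at x)"
      by (rule has_derivative_compose[OF f(1)[OF x] h1])
    moreover have "frechet_derivative h (at (f x)) (frechet_derivative f (at x) v) = ?D v x" for v
      by (rule linear_euclidean_representation[OF has_derivative_linear[OF h1]])
    ultimately show "((\<lambda>x. h (f x)) has_derivative (\<lambda>v. ?D v x)) (at x)" by simp
  next
    show "Cq_open q (?D v) S" for v
      by (intro Cq_open_sum Cq_open_scaleR Cq_open_inner_left assms(1) f(2) Suc.IH[OF f' h(2)])
  qed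
qed

lemma Cq_open_Pair:
  assumes "open S" "Cq_open q f S" "Cq_open q g S"
  shows "Cq_open q (\<lambda>x. (f x, g x)) S"
proof -
  have "Cq_open q (\<lambda>x. (f x, 0) + (0, g x)) S"
    by (intro Cq_open_add assms Cq_open_linear_compose[where L="\<lambda>y. (y, 0)"]
        Cq_open_linear_compose[where L="\<lambda>y. (0, y)"]) (auto intro!: linearI)
  then show ?thesis by simp
qed

section \<open>C^q dependence of the inverse of a linear map\<close>

text \<open>Write \<open>k x\<close> as \<open>k z\<close> plus \<open>k x - k z\<close>. As
  \<open>r\<close> vanishes at \<open>z\<close>, it is of first order there, and multiplied by the
  vanishing difference it is negligible; continuity of \<open>k\<close> at \<open>z\<close> thus
  suffices.\<close>

lemma has_derivative_scaleR_vanishing: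
  fixes k :: "'a::real_normed_vector \<Rightarrow> 'b::real_normed_vector"
  assumes r: "(r has_derivative r') (at z)" "r z = 0" and k: "isCont k z"
  shows "((\<lambda>x. r x *\<^sub>R k x) has_derivative (\<lambda>h. r' h *\<^sub>R k z)) (at z)"
proof -
  interpret bounded_linear r' using r(1) by (rule has_derivative_bounded_linear)
  have "((\<lambda>x. r x *\<^sub>R k z) has_derivative (\<lambda>h. r' h *\<^sub>R k z)) (at z)"
    using r(1) by (rule has_derivative_scaleR_left)
  moreover have "((\<lambda>x. r x *\<^sub>R (k x - k z)) has_derivative (\<lambda>h. 0)) (at z)"
    unfolding has_derivative_at2
  proof (intro conjI)
    obtain B where B: "B > 0" "\<And>x. norm (r' x) \<le> norm x * B" using pos_bounded by blast
    \<comment> \<open>The first factor bounds the difference quotient of \<open>r\<close>: a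
      remainder tending to 0 plus the bound \<open>B\<close> of \<open>r'\<close>. The second tends
      to 0 by continuity of \<open>k\<close>.\<close>
    have lim0: "((\<lambda>y. (norm ((r y - r z) - r' (y - z)) / norm (y - z) + B) * norm (k y - k z)) \<longlongrightarrow> (0 + B) * 0) (at z)"
    proof (intro tendsto_intros)
      have "((\<lambda>y. norm ((1 / norm (y - z)) *\<^sub>R (r y - (r z + r' (y - z))))) \<longlongrightarrow> norm (0::real)) (at z)"
        using r(1) unfolding has_derivative_at2 by (intro tendsto_norm) auto
      then show "((\<lambda>y. norm ((r y - r z) - r' (y - z)) / norm (y - z)) \<longlongrightarrow> 0) (at z)"
        by (simp add: abs_mult diff_diff_eq)
      show "((\<lambda>y. norm (k y - k z)) \<longlongrightarrow> 0) (at z)"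
        using k unfolding isCont_def by (metis LIM_zero tendsto_norm_zero)
    qed
    show "((\<lambda>y. (1 / norm (y - z)) *\<^sub>R (r y *\<^sub>R (k y - k z) - (r z *\<^sub>R (k z - k z) + 0))) \<longlongrightarrow> 0) (at z)"
    proof (rule Lim_null_comparison[OF _ lim0[unfolded mult_zero_right]])
      show "\<forall>\<^sub>F y in at z. norm ((1 / norm (y - z)) *\<^sub>R (r y *\<^sub>R (k y - k z) - (r z *\<^sub>R (k z - k z) + 0)))
          \<le> (norm ((r y - r z) - r' (y - z)) / norm (y - z) + B) * norm (k y - k z)"
      proof (rule eventually_at_topological[THEN iffD2], intro exI[of _ UNIV] conjI ballI impI)
        fix y assume "y \<noteq> z"
        then have n: "norm (y - z) > 0" by simp
        have "\<bar>r y\<bar> \<le> \<bar>(r y - r z) - r' (y - z)\<bar> + \<bar>r' (y - z)\<bar>" using r(2) by linarith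
        also have "\<bar>r' (y - z)\<bar> \<le> norm (y - z) * B" using B(2)[of "y - z"] by simp
        finally have "\<bar>r y\<bar> / norm (y - z) \<le> norm ((r y - r z) - r' (y - z)) / norm (y - z) + B"
          using n by (simp add: field_simps)
        from mult_right_mono[OF this norm_ge_zero, of "k y - k z"]
        show "norm ((1 / norm (y - z)) *\<^sub>R (r y *\<^sub>R (k y - k z) - (r z *\<^sub>R (k z - k z) + 0)))
          \<le> (norm ((r y - r z) - r' (y - z)) / norm (y - z) + B) * norm (k y - k z)"
          by simp
      qed auto
    qed
  qed auto
  ultimately have "((\<lambda>x. r x *\<^sub>R k z + r x *\<^sub>R (k x - k z)) has_derivative (\<lambda>h. r' h *\<^sub>R k z + 0)) (at z)"
    by (rule has_derivative_add)
  then show ?thesis by (simp add: algebra_simps)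
qed

text \<open>A lower bound \<open>c\<close> for \<open>A z\<close> persists as \<open>c / 2\<close>
  for nearby \<open>A x\<close>. With \<open>u\<close> the preimage of \<open>v\<close> under
  \<open>A z\<close>, applying \<open>A x\<close> to the difference of the two preimages gives
  \<open>A z u - A x u\<close>, which tends to 0.\<close>

lemma isCont_inv_linear:
  fixes A :: "'z::t2_space \<Rightarrow> 'e::euclidean_space \<Rightarrow> 'e"
  assumes "open S" "z \<in> S" and lin: "\<And>z. z \<in> S \<Longrightarrow> linear (A z)"
    and bij: "\<And>z. z \<in> S \<Longrightarrow> bij (A z)"
    and cont: "\<And>w. continuous_on S (\<lambda>z. A z w)"
  shows "isCont (\<lambda>z. inv (A z) v) z"
proof -
  have tA: "((\<lambda>x. A x w) \<longlongrightarrow> A z w) (at z)" for w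
    using cont[of w] assms(1,2) by (simp add: continuous_on_eq_continuous_at isCont_def)
  have inS: "\<forall>\<^sub>F x in at z. x \<in> S" using assms(1,2) by (rule eventually_at_in_open')
  interpret z: linear "A z" by (rule lin[OF assms(2)])
  obtain c where c: "c > 0" "\<And>x. c * norm x \<le> norm (A z x)"
    using linear_inj_bounded_below_pos[OF lin[OF assms(2)] bij_is_inj[OF bij[OF assms(2)]]]
    by (metis mult.commute)
  \<comment> \<open>Closeness on the finitely many basis vectors controls the operator norm of
    \<open>A x - A z\<close>, so pointwise continuity is enough.\<close>
  have "((\<lambda>x. \<Sum>b\<in>Basis. norm (A x b - A z b)) \<longlongrightarrow> (\<Sum>b\<in>(Basis::'e set). 0)) (at z)"
    by (intro tendsto_sum tendsto_norm_zero LIM_zero tA)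
  then have small: "\<forall>\<^sub>F x in at z. (\<Sum>b\<in>Basis. norm (A x b - A z b)) < c / 2"
    using c(1) by (intro order_tendstoD(2)[where y=0]) auto
  have "((\<lambda>x. inv (A x) v - inv (A z) v) \<longlongrightarrow> 0) (at z)"
  proof (rule Lim_null_comparison)
    show "((\<lambda>x. 2 / c * norm (A x (inv (A z) v) - A z (inv (A z) v))) \<longlongrightarrow> 0) (at z)"
      using tA by (intro tendsto_mult_right_zero tendsto_norm_zero LIM_zero)
    show "\<forall>\<^sub>F x in at z. norm (inv (A x) v - inv (A z) v)
        \<le> 2 / c * norm (A x (inv (A z) v) - A z (inv (A z) v))"
      using small inS
    proof eventually_elim
      case (elim x)
      interpret x: linear "A x" by (rule lin[OF elim(2)])
      have lower: "c / 2 * norm y \<le> norm (A x y)" for y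
      proof -
        have "linear (\<lambda>y. A x y - A z y)" using x.linear_axioms z.linear_axioms by (rule linear_compose_sub)
        then have "A x y - A z y = (\<Sum>b\<in>Basis. (y \<bullet> b) *\<^sub>R (A x b - A z b))"
          by (rule linear_euclidean_representation)
        also have "norm \<dots> \<le> (\<Sum>b\<in>Basis. norm y * norm (A x b - A z b))"
          by (rule sum_norm_le) (auto intro!: mult_right_mono Basis_le_norm)
        also have "\<dots> = norm y * (\<Sum>b\<in>Basis. norm (A x b - A z b))" by (simp add: sum_distrib_left)
        also have "\<dots> \<le> norm y * (c / 2)" using elim(1) by (intro mult_left_mono) auto
        finally have "norm (A x y - A z y) \<le> norm y * (c / 2)" .
        moreover have "norm (A z y) \<le> norm (A x y) + norm (A x y - A z y)"
          by (metis norm_minus_commute norm_triangle_sub)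
        ultimately show ?thesis using c(2)[of y] by (simp add: algebra_simps)
      qed
      have "A x (inv (A x) v) = v" "A z (inv (A z) v) = v"
        using bij[OF elim(2)] bij[OF assms(2)] by (simp_all add: bij_is_surj surj_f_inv_f)
      then have "c / 2 * norm (inv (A x) v - inv (A z) v) \<le> norm (A x (inv (A z) v) - A z (inv (A z) v))"
        using lower[of "inv (A x) v - inv (A z) v"] by (simp add: x.diff norm_minus_commute)
      then show ?case using c(1) by (simp add: field_simps)
    qed
  qed
  then show ?thesis unfolding isCont_def by (rule LIM_zero_cancel)
qed

text \<open>Near \<open>z\<close>, with \<open>u = (A z)\<^sup>-\<^sup>1 v\<close>, one has \<open>(A x)\<^sup>-\<^sup>1 v = u + (A x)\<^sup>-\<^sup>1 (v - A x u)\<close>, and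
  \<open>v - A x u\<close> vanishes at \<open>x = z\<close>; so continuity of the inverse already gives its derivative, which
  is again a polynomial in inverses and derivatives of \<open>A\<close>.\<close>

lemma Cq_open_inv_linear:
  fixes A :: "'z::euclidean_space \<Rightarrow> 'e::euclidean_space \<Rightarrow> 'e"
  assumes S: "open S" and lin: "\<And>z. z \<in> S \<Longrightarrow> linear (A z)"
    and bij: "\<And>z. z \<in> S \<Longrightarrow> bij (A z)"
    and A: "\<And>w. Cq_open q (\<lambda>z. A z w) S"
  shows "Cq_open q (\<lambda>z. inv (A z) v) S"
  using A
proof (induction q arbitrary: v)
  case 0
  have "isCont (\<lambda>z. inv (A z) v) z" if "z \<in> S" for z
    by (rule isCont_inv_linear[OF S that lin bij]) (use 0 in auto)
  then show ?case by (simp add: continuous_at_imp_continuous_on)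
next
  case (Suc q)
  note IH = Suc.IH[OF Cq_open_Suc_imp[OF Suc.prems]]
  note d = Cq_open_SucD[OF Suc.prems]
  \<comment> \<open>This is the classical derivative of the inverse, minus inverse times derivative
    of \<open>A\<close> times inverse: \<open>c\<close> expands the inner inverse applied to
    \<open>v\<close>, \<open>b\<close> the argument of the outer one.\<close>
  let ?D = "\<lambda>h z. \<Sum>b\<in>Basis. (\<Sum>c\<in>Basis. (inv (A z) v \<bullet> c) *\<^sub>R
      (- (frechet_derivative (\<lambda>z. A z c) (at z) h \<bullet> b))) *\<^sub>R inv (A z) b"
  show ?case
  proof (rule Cq_open_SucI[OF S])
    show "Cq_open q (?D h) S" for h
      by (intro Cq_open_sum Cq_open_scaleR S Cq_open_inner_left IH
          Cq_open_linear_compose[where L="\<lambda>x. - x"] d(2))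
        (auto intro: linearI)
  next
    fix z assume z: "z \<in> S"
    define u where "u = inv (A z) v"
    \<comment> \<open>\<open>r\<close> is \<open>A x u\<close> with \<open>u\<close> frozen at
      \<open>z\<close>, expanded so that its derivative follows from those of the columns
      \<open>A x c\<close>.\<close>
    define r where "r x = (\<Sum>c\<in>Basis. (u \<bullet> c) *\<^sub>R A x c)" for x
    have r: "r x = A x u" if "x \<in> S" for x
      unfolding r_def by (rule linear_euclidean_representation[OF lin[OF that], symmetric])
    have rz: "r z = v"
      using r[OF z] bij[OF z] by (simp add: u_def bij_is_surj surj_f_inv_f)
    have dr: "((\<lambda>x. (v - r x) \<bullet> b) has_derivative (\<lambda>h. (\<Sum>c\<in>Basis. (u \<bullet> c) *\<^sub>R
      (- (frechet_derivative (\<lambda>z. A z c) (at z) h \<bullet> b))))) (at z)" for b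
    proof -
      have "((\<lambda>x. (v - r x) \<bullet> b) has_derivative
          (\<lambda>h. (0 - (\<Sum>c\<in>Basis. (u \<bullet> c) *\<^sub>R frechet_derivative (\<lambda>z. A z c) (at z) h)) \<bullet> b)) (at z)"
        unfolding r_def
        by (intro has_derivative_inner_left has_derivative_diff has_derivative_const
            has_derivative_sum has_derivative_scaleR_right d(1)[OF z])
      then show ?thesis by (simp add: inner_sum_left sum_negf)
    qed
    have "((\<lambda>x. u + (\<Sum>b\<in>Basis. ((v - r x) \<bullet> b) *\<^sub>R inv (A x) b)) has_derivative (\<lambda>h. ?D h z)) (at z)"
    proof (rule has_derivative_eq_rhs[OF has_derivative_add[OF has_derivative_const has_derivative_sum]])
      show "((\<lambda>x. ((v - r x) \<bullet> b) *\<^sub>R inv (A x) b) has_derivative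
         (\<lambda>h. (\<Sum>c\<in>Basis. (u \<bullet> c) *\<^sub>R
      (- (frechet_derivative (\<lambda>z. A z c) (at z) h \<bullet> b))) *\<^sub>R inv (A z) b)) (at z)" for b
        by (rule has_derivative_scaleR_vanishing[OF dr])
          (simp add: rz, rule isCont_inv_linear[OF S z lin bij Cq_open_imp_continuous_on[OF Suc.prems]])
    qed (simp add: u_def)
    then show "((\<lambda>x. inv (A x) v) has_derivative (\<lambda>h. ?D h z)) (at z)"
    proof (rule has_derivative_transform_within_open[OF _ S z])
      fix x assume x: "x \<in> S"
      have li: "linear (inv (A x))" using lin[OF x] bij[OF x]
        by (simp add: bij_is_inj bij_is_surj inj_linear_imp_inv_linear)
      have "(\<Sum>b\<in>Basis. ((v - r x) \<bullet> b) *\<^sub>R inv (A x) b) = inv (A x) (v - r x)"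
        by (rule linear_euclidean_representation[OF li, symmetric])
      also have "\<dots> = inv (A x) v - u"
        using bij[OF x] by (simp add: linear_diff[OF li] r[OF x] bij_is_inj)
      finally show "u + (\<Sum>b\<in>Basis. ((v - r x) \<bullet> b) *\<^sub>R inv (A x) b) = inv (A x) v" by simp
    qed
  qed
qed

section \<open>Inverse functions and local left inverses of class C^q\<close>

text \<open>The C^1 inverse function theorem gives \<open>R\<close> with derivative the inverse of
  that of \<open>\<Phi>\<close> at \<open>R y\<close>. Regularity is then bootstrapped: if
  \<open>R\<close> is C^k, so is this formula, and \<open>R\<close> gains one order.\<close>

lemma Cq_open_inverse_function:
  fixes \<Phi> :: "'a::euclidean_space \<Rightarrow> 'a"
  assumes S: "open S" and p: "p \<in> S" and \<Phi>: "Cq_open (Suc q) \<Phi> S"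
    and id: "frechet_derivative \<Phi> (at p) = id"
  obtains T V R where "open T" "T \<subseteq> S" "p \<in> T" "open V" "homeomorphism T V \<Phi> R" "Cq_open (Suc q) R V"
proof -
  note d = Cq_open_SucD[OF \<Phi>]
  \<comment> \<open>The derivative is packaged as a bounded operator, whose continuity in
    \<open>x\<close> reduces to that of its directional values.\<close>
  define D where "D x = Blinfun (frechet_derivative \<Phi> (at x))" for x
  have Dapp: "blinfun_apply (D x) = frechet_derivative \<Phi> (at x)" if "x \<in> S" for x
    unfolding D_def using d(1)[OF that] by (intro bounded_linear_Blinfun_apply has_derivative_bounded_linear)
  have cont: "continuous_on S D"
    using Cq_open_imp_continuous_on[OF d(2)]
    by (intro continuous_on_blinfun_componentwise) (simp add: Dapp cong: continuous_on_cong)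
  have inv: "id_blinfun o\<^sub>L D p = id_blinfun"
    by (rule blinfun_eqI) (simp add: Dapp[OF p] id)
  obtain T V R R' where T: "open T" "T \<subseteq> S" "p \<in> T" "open V" "homeomorphism T V \<Phi> R"
    and R: "\<And>y. y \<in> V \<Longrightarrow> (R has_derivative R' y) (at y)"
      "\<And>y. y \<in> V \<Longrightarrow> R' y = inv (D (R y))" "\<And>y. y \<in> V \<Longrightarrow> bij (D (R y))"
    by (rule inverse_function_theorem[OF S _ cont p inv, of \<Phi>]) (use Dapp d(1) in \<open>simp, blast\<close>)
  have RT: "R ` V \<subseteq> T" using T(5) by (auto simp: homeomorphism_def)
  have RS: "R y \<in> S" if "y \<in> V" for y using that RT T(2) by auto
  have "Cq_open k R V \<Longrightarrow> k \<le> q \<Longrightarrow> Cq_open (Suc k) R V" for k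
  proof -
    assume k: "Cq_open k R V" "k \<le> q"
    \<comment> \<open>The derivative of \<open>\<Phi>\<close> has order \<open>q\<close>; it is
      lowered step by step to the order \<open>k\<close> so far known for \<open>R\<close>.\<close>
    have "Cq_open k (\<lambda>x. frechet_derivative \<Phi> (at x) w) T" for w
      using k(2) Cq_open_subset[OF T(2) d(2)[of w]]
      by (induction rule: inc_induct) (auto intro: Cq_open_Suc_imp simp del: Cq_open.simps(2))
    then have c: "Cq_open k (\<lambda>y. frechet_derivative \<Phi> (at (R y)) w) V" for w
      by (intro Cq_open_compose[OF T(4,1) RT k(1)])
    show "Cq_open (Suc k) R V"
    proof (rule Cq_open_SucI[OF T(4)])
      show "(R has_derivative (\<lambda>v. inv (frechet_derivative \<Phi> (at (R y))) v)) (at y)" if "y \<in> V" for y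
        using R(1,2)[OF that] Dapp[OF RS[OF that]] by simp
      show "Cq_open k (\<lambda>y. inv (frechet_derivative \<Phi> (at (R y))) v) V" for v
        by (rule Cq_open_inv_linear[OF T(4) _ _ c])
          (use R(3) Dapp RS d(1) has_derivative_linear in \<open>metis+\<close>)
    qed
  qed
  moreover have "Cq_open 0 R V" using T(5) by (simp add: homeomorphism_def)
  \<comment> \<open>The last gain is at \<open>k = q\<close>, so \<open>R\<close> attains the full
    order \<open>Suc q\<close> of \<open>\<Phi>\<close>.\<close>
  ultimately have "Cq_open (Suc k) R V" if "k \<le> q" for k using that
    by (induction k) (auto simp del: Cq_open.simps(2))
  then show thesis using T that by blast
qed

text \<open>The inverse of \<open>L\<close> after \<open>F\<close> lives on \<open>V\<close> in the
  source space; pulling \<open>V\<close> back along \<open>L\<close> gives an open set of the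
  ambient target space, where the left inverse is C^q also off the image of
  \<open>F\<close>.\<close>

lemma Cq_immersion_local_left_inverse:
  fixes F :: "'a::euclidean_space \<Rightarrow> 'b::euclidean_space"
  assumes S: "open S" and p: "p \<in> S" and F: "Cq_open (Suc q) F S"
    and inj: "inj (frechet_derivative F (at p))"
  obtains T N R where "open T" "p \<in> T" "T \<subseteq> S" "open N" "F ` T \<subseteq> N" "R ` N \<subseteq> T"
    "Cq_open (Suc q) R N" "\<And>x. x \<in> T \<Longrightarrow> R (F x) = x"
proof -
  note d = Cq_open_SucD(1)[OF F p]
  obtain L where L: "linear L" "L \<circ> frechet_derivative F (at p) = id"
    using linear_injective_left_inverse[OF has_derivative_linear[OF d] inj] by blast
  have "((\<lambda>x. L (F x)) has_derivative (\<lambda>v. L (frechet_derivative F (at p) v))) (at p)"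
    using L(1) by (rule bounded_linear.has_derivative[OF linear_conv_bounded_linear[THEN iffD1] d])
  moreover have "(\<lambda>v. L (frechet_derivative F (at p) v)) = id" using L(2) by (simp add: comp_def)
  ultimately have "((\<lambda>x. L (F x)) has_derivative id) (at p)" by simp
  then have "frechet_derivative (\<lambda>x. L (F x)) (at p) = id"
    by (rule frechet_derivative_at[symmetric])
  moreover have "Cq_open (Suc q) (\<lambda>x. L (F x)) S" by (rule Cq_open_linear_compose[OF S L(1) F])
  ultimately obtain T V R where T: "open T" "T \<subseteq> S" "p \<in> T" "open V"
    and hom: "homeomorphism T V (\<lambda>x. L (F x)) R" and R: "Cq_open (Suc q) R V"
    using Cq_open_inverse_function[OF S p] by metis
  have N: "open (L -` V)"
    using L(1) T(4) by (intro open_vimage) (auto simp: linear_conv_bounded_linear linear_continuous_on)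
  show thesis
  proof (rule that[OF T(1,3,2) N, of "\<lambda>y. R (L y)"])
    show "Cq_open (Suc q) (\<lambda>y. R (L y)) (L -` V)"
      by (rule Cq_open_compose[OF N T(4) _ Cq_open_linear[OF N L(1)] R]) auto
  qed (use hom in \<open>auto simp: homeomorphism_def\<close>)
qed

section \<open>Factoring through an injective immersion\<close>

lemma Cq_on_image_factorI:
  assumes q: "1 \<le> q" and g: "Cq_on q g S" and W: "Cq_immersion_on q W S"
    and h: "\<And>x. x \<in> S \<Longrightarrow> h (W x) = g x"
  shows "Cq_on_image q W S h"
  unfolding Cq_on_image_def
proof
  fix p assume p: "p \<in> S"
  obtain k where k: "q = Suc k" using q by (cases q) auto
  obtain N1 g' where g': "open N1" "p \<in> N1" "Cq_open q g' N1" "\<And>y. y \<in> N1 \<inter> S \<Longrightarrow> g' y = g y"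
    using g p by (auto simp: Cq_on_def Cq_extension_def)
  obtain N2 F where F: "open N2" "p \<in> N2" "Cq_open q F N2" "\<And>y. y \<in> N2 \<inter> S \<Longrightarrow> F y = W y"
      "inj (frechet_derivative F (at p))"
    using W p by (auto simp: Cq_immersion_on_def Cq_extension_def)
  \<comment> \<open>Inside \<open>N1\<close> the extension \<open>g'\<close> of \<open>g\<close> is
    available, inside \<open>N2\<close> the extension \<open>F\<close> of \<open>W\<close>. As
    \<open>R\<close> maps \<open>N\<close> into \<open>T\<close>, the composition with
    \<open>g'\<close> stays C^q on all of \<open>N\<close>.\<close>
  have "open (N1 \<inter> N2)" "p \<in> N1 \<inter> N2" using g' F by auto
  moreover have "Cq_open (Suc k) F (N1 \<inter> N2)"
    by (rule Cq_open_subset[OF _ F(3)[unfolded k]]) auto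
  ultimately obtain T N R where T: "open T" "p \<in> T" "T \<subseteq> N1 \<inter> N2" "open N" "F ` T \<subseteq> N" "R ` N \<subseteq> T"
      and R: "Cq_open (Suc k) R N" "\<And>x. x \<in> T \<Longrightarrow> R (F x) = x"
    using Cq_immersion_local_left_inverse[OF _ _ _ F(5)] by metis
  have FW: "F y = W y" if "y \<in> T" "y \<in> S" for y using F(4)[of y] T(3) that by blast
  have "Cq_extension q h (W ` (T \<inter> S)) (W p) N (\<lambda>y. g' (R y))"
    unfolding Cq_extension_def
  proof (intro conjI ballI)
    show "W p \<in> N" using FW[OF T(2) p] T(2,5) by auto
    show "Cq_open q (\<lambda>y. g' (R y)) N"
      by (rule Cq_open_compose[OF T(4) g'(1) _ _ g'(3)]) (use R(1) T(3,6) k in auto)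
  next
    fix y assume "y \<in> N \<inter> W ` (T \<inter> S)"
    then obtain x where x: "x \<in> T" "x \<in> S" "y = W x" by auto
    then have "R y = x" using R(2) FW by metis
    then show "g' (R y) = h y" using g'(4)[of x] x h T(3) by auto
  qed (fact T(4))
  moreover have "W ` (T \<inter> S) \<subseteq> N"
  proof
    fix y assume "y \<in> W ` (T \<inter> S)"
    then obtain x where "x \<in> T" "x \<in> S" "y = W x" by auto
    then show "y \<in> N" using FW[of x] T(5) by auto
  qed
  ultimately show "\<exists>T. open T \<and> p \<in> T \<and> (\<exists>N F. Cq_extension q h (W ` (T \<inter> S)) (W p) N F \<and>
        W ` (T \<inter> S) \<subseteq> N)"
    using T(1,2) by blast
qed

text \<open>The local extension acts on each factor separately, so its derivative is block diagonal
  and injective because both blocks are. This lets the factorisation treat the two types as a single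
  variable.\<close>

lemma Cq_immersion_on_map_prod:
  fixes U :: "'a::euclidean_space \<Rightarrow> 'l::euclidean_space" and V :: "'c::euclidean_space \<Rightarrow> 'f::euclidean_space"
  assumes q: "1 \<le> q" and U: "Cq_immersion_on q U A" and V: "Cq_immersion_on q V B"
  shows "Cq_immersion_on q (map_prod U V) (A \<times> B)"
  unfolding Cq_immersion_on_def
proof
  fix p assume p: "p \<in> A \<times> B"
  then obtain a c where ac: "p = (a, c)" "a \<in> A" "c \<in> B" by auto
  obtain k where k: "q = Suc k" using q by (cases q) auto
  obtain N1 F where F: "open N1" "a \<in> N1" "Cq_open q F N1" "\<And>y. y \<in> N1 \<inter> A \<Longrightarrow> F y = U y"
      "inj (frechet_derivative F (at a))"
    using U ac by (auto simp: Cq_immersion_on_def Cq_extension_def)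
  obtain N2 H where H: "open N2" "c \<in> N2" "Cq_open q H N2" "\<And>y. y \<in> N2 \<inter> B \<Longrightarrow> H y = V y"
      "inj (frechet_derivative H (at c))"
    using V ac by (auto simp: Cq_immersion_on_def Cq_extension_def)
  have N: "open (N1 \<times> N2)" using F(1) H(1) by (rule open_Times)
  have "Cq_open q (\<lambda>p. (F (fst p), H (snd p))) (N1 \<times> N2)"
    by (intro Cq_open_Pair N Cq_open_compose[OF N F(1) _ _ F(3)] Cq_open_compose[OF N H(1) _ _ H(3)]
        Cq_open_linear linear_fst linear_snd) auto
  then have "Cq_extension q (map_prod U V) (A \<times> B) p (N1 \<times> N2) (\<lambda>p. (F (fst p), H (snd p)))"
    using N F H ac by (auto simp: Cq_extension_def)
  moreover have "inj (frechet_derivative (\<lambda>p. (F (fst p), H (snd p))) (at p))"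
  proof -
    let ?F = "frechet_derivative F (at a)" and ?H = "frechet_derivative H (at c)"
    have dF: "(F has_derivative ?F) (at (fst p))" and dH: "(H has_derivative ?H) (at (snd p))"
      using Cq_open_SucD(1)[OF F(3)[unfolded k] F(2)] Cq_open_SucD(1)[OF H(3)[unfolded k] H(2)] ac by auto
    have "((\<lambda>p. (F (fst p), H (snd p))) has_derivative (\<lambda>v. (?F (fst v), ?H (snd v)))) (at p)"
      by (intro has_derivative_Pair has_derivative_compose[OF has_derivative_fst[OF has_derivative_ident] dF]
          has_derivative_compose[OF has_derivative_snd[OF has_derivative_ident] dH])
    from frechet_derivative_at[OF this] have "frechet_derivative (\<lambda>p. (F (fst p), H (snd p))) (at p)
        = (\<lambda>v. (?F (fst v), ?H (snd v)))" by simp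
    then show ?thesis using F(5) H(5) by (auto simp: inj_def prod_eq_iff)
  qed
  ultimately show "\<exists>N F. Cq_extension q (map_prod U V) (A \<times> B) p N F \<and> inj (frechet_derivative F (at p))"
    by blast
qed

section \<open>Identification, local modulus and smoothness of the regression function\<close>

theorem theorem1:
  fixes M :: "'w measure"
    and E :: "'e measure"
    and \<alpha> :: "nat \<Rightarrow> 'w \<Rightarrow> 'a::euclidean_space"
    and \<gamma> :: "nat \<Rightarrow> 'w \<Rightarrow> 'c::euclidean_space"
    and \<eta> :: "nat \<Rightarrow> nat \<Rightarrow> 'w \<Rightarrow> 'e"
    and m :: "'a \<Rightarrow> 'c \<Rightarrow> 'e \<Rightarrow> 'y::euclidean_space"
    and Y :: "nat \<Rightarrow> nat \<Rightarrow> 'w \<Rightarrow> 'y"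
    and G :: "'y \<Rightarrow> 'g::euclidean_space"
    and g :: "'a \<times> 'c \<Rightarrow> 'g"
    and \<Omega>\<alpha> :: "'a set" and \<Omega>\<gamma> :: "'c set"
    and U :: "'a \<Rightarrow> 'l::euclidean_space" and V :: "'c \<Rightarrow> 'f::euclidean_space"
    and lam :: "nat \<Rightarrow> 'w \<Rightarrow> 'l" and f :: "nat \<Rightarrow> 'w \<Rightarrow> 'f"
  defines "g0 \<equiv> factor_regression \<Omega>\<alpha> \<Omega>\<gamma> U V g"
  assumes prob: "prob_space M"
    and alpha_rv: "\<And>i. i \<ge> 1 \<Longrightarrow> \<alpha> i \<in> borel_measurable M"
    and gamma_rv: "\<And>t. t \<ge> 1 \<Longrightarrow> \<gamma> t \<in> borel_measurable M"
    and eta_rv: "\<And>i t. i \<ge> 1 \<Longrightarrow> t \<ge> 1 \<Longrightarrow> \<eta> i t \<in> M \<rightarrow>\<^sub>M E"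
    and Y_rv: "\<And>i t. i \<ge> 1 \<Longrightarrow> t \<ge> 1 \<Longrightarrow> Y i t \<in> borel_measurable M"
    and alpha_supp: "common_support M {1..} \<alpha> \<Omega>\<alpha>"
    and gamma_supp: "common_support M {1..} \<gamma> \<Omega>\<gamma>"
    and model: "\<And>i t. i \<ge> 1 \<Longrightarrow> t \<ge> 1 \<Longrightarrow> AE w in M. Y i t w = m (\<alpha> i w) (\<gamma> t w) (\<eta> i t w)"
    and G_meas: "G \<in> borel_measurable borel"
    and G_integrable: "\<And>i t. i \<ge> 1 \<Longrightarrow> t \<ge> 1 \<Longrightarrow> integrable M (\<lambda>w. G (Y i t w))"
    and g_meas: "g \<in> borel_measurable (restrict_space borel (\<Omega>\<alpha> \<times> \<Omega>\<gamma>))"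
    and g_cond_exp: "\<And>i t. i \<ge> 1 \<Longrightarrow> t \<ge> 1 \<Longrightarrow>
      AE w in M. vec_cond_exp M (sigma_gen M (\<lambda>w. (\<alpha> i w, \<gamma> t w))) (\<lambda>w. G (Y i t w)) w
        = g (\<alpha> i w, \<gamma> t w)"
    and invariant: "invariant_cond_distribution M (\<Omega>\<alpha> \<times> \<Omega>\<gamma>)
      (\<lambda>i t w. (\<alpha> i w, \<gamma> t w)) (\<lambda>i t w. G (Y i t w))"
    and U_meas: "U \<in> borel_measurable (restrict_space borel \<Omega>\<alpha>)"
    and V_meas: "V \<in> borel_measurable (restrict_space borel \<Omega>\<gamma>)"
    and lam_rv: "\<And>i. i \<ge> 1 \<Longrightarrow> lam i \<in> borel_measurable M"
    and f_rv: "\<And>t. t \<ge> 1 \<Longrightarrow> f t \<in> borel_measurable M"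
    and lam_eq: "\<And>i. i \<ge> 1 \<Longrightarrow> AE w in M. lam i w = U (\<alpha> i w)"
    and f_eq: "\<And>t. t \<ge> 1 \<Longrightarrow> AE w in M. f t w = V (\<gamma> t w)"
    and lam_identified: "\<And>i. i \<ge> 1 \<Longrightarrow> identified_from M Y (lam i)"
    and f_identified: "\<And>t. t \<ge> 1 \<Longrightarrow> identified_from M Y (f t)"
    and U_inj: "inj_on U \<Omega>\<alpha>" and V_inj: "inj_on V \<Omega>\<gamma>"
  shows
    "(\<forall>i\<ge>1. \<forall>t\<ge>1.
        (AE w in M.
           vec_cond_exp M (sigma_gen M (\<lambda>w. (lam i w, f t w))) (\<lambda>w. G (Y i t w)) w
             = g0 (lam i w, f t w) \<and>
           g0 (lam i w, f t w) = g (\<alpha> i w, \<gamma> t w) \<and>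
           g (\<alpha> i w, \<gamma> t w) = g (inv_into \<Omega>\<alpha> U (lam i w), inv_into \<Omega>\<gamma> V (f t w))) \<and>
        identified_from M Y (\<lambda>w. g (\<alpha> i w, \<gamma> t w)))
     \<and>
     (\<forall>\<delta> C :: 'a \<times> 'c \<Rightarrow> real.
        (\<forall>p \<in> \<Omega>\<alpha> \<times> \<Omega>\<gamma>. \<delta> p > 0 \<and>
           (\<forall>p' \<in> \<Omega>\<alpha> \<times> \<Omega>\<gamma>. norm (p - p') < \<delta> p \<longrightarrow>
              norm (g p - g p') \<le> C p * (norm (fst p - fst p') + norm (snd p - snd p')))) \<longrightarrow>
        (\<forall>a \<in> \<Omega>\<alpha>. \<forall>c \<in> \<Omega>\<gamma>. \<forall>a' \<in> \<Omega>\<alpha>. \<forall>c' \<in> \<Omega>\<gamma>.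
           norm ((a, c) - (a', c')) < \<delta> (a, c) \<longrightarrow>
           norm (g0 (U a, V c) - g0 (U a', V c')) \<le> C (a, c) * (norm (a - a') + norm (c - c'))))
     \<and>
     (\<forall>q\<ge>1.
        Cq_on q g (\<Omega>\<alpha> \<times> \<Omega>\<gamma>) \<and> Cq_immersion_on q U \<Omega>\<alpha> \<and> Cq_immersion_on q V \<Omega>\<gamma> \<longrightarrow>
        Cq_on_image q (map_prod U V) (\<Omega>\<alpha> \<times> \<Omega>\<gamma>) g0)"
proof (intro conjI allI impI ballI)
  fix i t :: nat
  assume i: "i \<ge> 1" and t: "t \<ge> 1"
  have a\<Omega>: "AE w in M. \<alpha> i w \<in> \<Omega>\<alpha>" and c\<Omega>: "AE w in M. \<gamma> t w \<in> \<Omega>\<gamma>"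
    and \<Omega>: "\<Omega>\<alpha> \<in> sets borel" "\<Omega>\<gamma> \<in> sets borel"
    using alpha_supp gamma_supp i t by (auto simp: common_support_def)
  obtain h where h: "h \<in> borel_measurable borel" "AE w in M. h (lam i w, f t w) = g (\<alpha> i w, \<gamma> t w)"
    and ce: "AE w in M. vec_cond_exp M (sigma_gen M (\<lambda>w. (lam i w, f t w))) (\<lambda>w. G (Y i t w)) w
      = h (lam i w, f t w)"
    by (rule vec_cond_exp_injective_image[OF prob_space.finite_measure[OF prob]
          alpha_rv[OF i] gamma_rv[OF t] \<Omega> a\<Omega> c\<Omega> U_meas V_meas U_inj V_inj
          lam_rv[OF i] f_rv[OF t] lam_eq[OF i] f_eq[OF t] g_meas G_integrable[OF i t]
          g_cond_exp[OF i t]])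
  show "AE w in M.
           vec_cond_exp M (sigma_gen M (\<lambda>w. (lam i w, f t w))) (\<lambda>w. G (Y i t w)) w
             = g0 (lam i w, f t w) \<and>
           g0 (lam i w, f t w) = g (\<alpha> i w, \<gamma> t w) \<and>
           g (\<alpha> i w, \<gamma> t w) = g (inv_into \<Omega>\<alpha> U (lam i w), inv_into \<Omega>\<gamma> V (f t w))"
    \<comment> \<open>Almost surely the types lie in their supports, where \<open>inv_into\<close>
      undoes \<open>U\<close> and \<open>V\<close>; there \<open>g0\<close>, \<open>h\<close> and
      \<open>g\<close> agree along the realised types.\<close>
    using ce h(2) lam_eq[OF i] f_eq[OF t] a\<Omega> c\<Omega>
    by eventually_elim (simp add: g0_def factor_regression_def U_inj V_inj)
  show "identified_from M Y (\<lambda>w. g (\<alpha> i w, \<gamma> t w))"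
    \<comment> \<open>Identification needs a measurable function of the recovered types, and the
      Borel version \<open>h\<close> provides it.\<close>
    by (rule identified_from_Pair[OF lam_identified[OF i] f_identified[OF t] h])
next
  fix \<delta> C :: "'a \<times> 'c \<Rightarrow> real" and a c a' c'
  assume lip: "\<forall>p \<in> \<Omega>\<alpha> \<times> \<Omega>\<gamma>. \<delta> p > 0 \<and>
           (\<forall>p' \<in> \<Omega>\<alpha> \<times> \<Omega>\<gamma>. norm (p - p') < \<delta> p \<longrightarrow>
              norm (g p - g p') \<le> C p * (norm (fst p - fst p') + norm (snd p - snd p')))"
    and in\<Omega>: "a \<in> \<Omega>\<alpha>" "c \<in> \<Omega>\<gamma>" "a' \<in> \<Omega>\<alpha>" "c' \<in> \<Omega>\<gamma>"
    and close: "norm ((a, c) - (a', c')) < \<delta> (a, c)"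
  have "norm (g (a, c) - g (a', c'))
      \<le> C (a, c) * (norm (fst (a, c) - fst (a', c')) + norm (snd (a, c) - snd (a', c')))"
    using lip in\<Omega> close by (meson SigmaI)
  \<comment> \<open>By injectivity \<open>g0\<close> at the transformed types is \<open>g\<close> at
    the original ones, so the modulus of \<open>g\<close> carries over with the same
    \<open>\<delta>\<close> and \<open>C\<close>.\<close>
  then show "norm (g0 (U a, V c) - g0 (U a', V c')) \<le> C (a, c) * (norm (a - a') + norm (c - c'))"
    using in\<Omega> U_inj V_inj by (simp add: g0_def factor_regression_def)
next
  fix q :: nat
  assume q: "1 \<le> q"
    and C: "Cq_on q g (\<Omega>\<alpha> \<times> \<Omega>\<gamma>) \<and> Cq_immersion_on q U \<Omega>\<alpha> \<and> Cq_immersion_on q V \<Omega>\<gamma>"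
  show "Cq_on_image q (map_prod U V) (\<Omega>\<alpha> \<times> \<Omega>\<gamma>) g0"
  proof (rule Cq_on_image_factorI[OF q])
    show "Cq_immersion_on q (map_prod U V) (\<Omega>\<alpha> \<times> \<Omega>\<gamma>)"
      using C q by (intro Cq_immersion_on_map_prod) auto
    show "g0 (map_prod U V p) = g p" if "p \<in> \<Omega>\<alpha> \<times> \<Omega>\<gamma>" for p
      using that U_inj V_inj by (auto simp: g0_def factor_regression_def)
  qed (use C in simp)
qed

end
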